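(* Let $H$ be a contextuality scenario and $p\in\mathcal{G}(H)$ a probabilistic model. (a) $p\in\mathcal{CE}^n(H)$ if and only if $\alpha(\mathrm{NO}(H)^{\boxtimes n},p^{\otimes n})\leq 1$. (b) $p\in\mathcal{CE}^\infty(H)$ if and only if $\Theta(\mathrm{NO}(H),p)\leq 1$, or, equivalently, if and only if $\alpha(\mathrm{NO}(H),p)=\Theta(\mathrm{NO}(H),p)=1$.
   Context: A contextuality scenario is a hypergraph $H$ with finite vertex set $V(H)$ and edge set $E(H)\subseteq 2^{V(H)}$ such that $\bigcup_{e\in E(H)}e=V(H)$. A probabilistic model on $H$ is a map $p:V(H)\to[0,1]$ with $\sum_{v\in e}p(v)=1$ for all $e\in E(H)$; $\mathcal{G}(H)$ is the set of these. The non-orthogonality graph $\mathrm{NO}(H)$ is the undirected graph on $V(H)$ in which two distinct vertices $u,v$ are adjacent iff no edge $e\in E(H)$ satisfies $\{u,v\}\subseteq e$. Products of scenarios. The (binary) Foulis–Randall product $H_A\otimes H_B$ has vertex set $V(H_A)\times V(H_B)$ and as edges all sets $\bigcup_{a\in e_A}\{a\}\times f(a)$ with $e_A\in E(H_A)$, $f:e_A\to E(H_B)$, and all sets $\bigcup_{b\in e_B}f(b)\times\{b\}$ with $e_B\in E(H_B)$, $f:e_B\to E(H_A)$. For more than two scenarios $H_1,\ldots,H_n$ there are several products, all with vertex set $\prod_i V(H_i)$: – the minimal product, whose edges are the sets $\{(v_1,\ldots,v_n): v_i\in e_i\ \forall i\neq k,\ v_k\in f(\vec v)\}$, for a party $k$,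 edges $e_i\in E(H_i)$ for $i\neq k$, and a function $f$ assigning to each tuple $\vec v=(v_i)_{i\neq k}$ an edge $f(\vec v)\in E(H_k)$; – the maximal product, whose edges are the outcome sets $O(\mathcal{P})$ of all measurement protocols $\mathcal{P}$ for $\{1,\ldots,n\}$, where a measurement protocol for a set $S$ of parties is $\emptyset$ if $S=\emptyset$, and otherwise a triple $(k,e,f)$ with $k\in S$, $e\in E(H_k)$ and $f$ assigning to each $v\in e$ a measurement protocol $f(v)$ for $S\setminus\{k\}$; here $O(\emptyset)=\{\ast\}$ and $O((k,e,f))=\bigcup_{v\in e}\{v\}\times O(f(v))$, regarded as a subset of $\prod_{i\in S}V(H_i)$ (with $v$ in component $k$); – products intermediate between these, such as the iterated binary products with any bracketing. The notation $H_1\otimes\cdots\otimes H_n$ refers to any of these products, without distinguishing between them, and $H^{\otimes n}$ is such an $n$-fold product of $H$ with itself. Here $p^{\otimes n}(v_1,\dots,v_n)=p(v_1)\cdots p(v_n)$. $\mathcal{CE}^1(H)$ is the set of $p\in\mathcal{G}(H)$ with $\sum_{v\in I}p(v)\leq 1$ for every independent set $I$ of $\mathrm{NO}(H)$. For $n\in\mathbb{N}$, $p\in\mathcal{CE}^n(H)$ iff $p^{\otimes n}\in\mathcal{CE}^1(H^{\otimes n})$; $\mathcal{CE}^\infty(H)=\bigcap_{n\in\mathbb{N}}\mathcal{CE}^n(H)$. For a graph $G$ with weights $p:V(G)\to\mathbb{R}_{\geq0}$, $\alpha(G,p)$ is the largest total weight $\sum_{v\in I}p(v)$ of an independent set $I$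 of $G$. The strong product $G_1\boxtimes G_2$ has vertex set $V(G_1)\times V(G_2)$, with two distinct vertices adjacent iff in each component they are equal or adjacent; $G^{\boxtimes n}$ is the $n$-fold strong power. The weighted Shannon capacity is $\Theta(G,p)=\lim_{n\to\infty}\sqrt[n]{\alpha(G^{\boxtimes n},p^{\otimes n})}$.
   Formalization: Products are those whose edges include an iterated binary product's and lie in the maximal one's; the minimal product for n≥3 is left out, as the claim fails there (7-cycle, p=1/2, n=4). α=Θ=1 is stated only for nonempty V(H), since for empty V(H) both are 0. *)

theory Defs
  imports Complex_Main "HOL-Library.FuncSet"
begin

section \<open>Contextuality scenarios and probabilistic models\<close>

record 'a hypergraph =
  verts :: "'a set"
  edges :: "'a set set"

definition contextuality_scenario :: "'a hypergraph \<Rightarrow> bool" where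
  "contextuality_scenario H \<longleftrightarrow>
     finite (verts H) \<and> edges H \<subseteq> Pow (verts H) \<and> \<Union> (edges H) = verts H"

text \<open>Models are total functions; only their values on the vertex set matter.\<close>

definition prob_models :: "'a hypergraph \<Rightarrow> ('a \<Rightarrow> real) set" where
  "prob_models H =
     {p. (\<forall>v\<in>verts H. 0 \<le> p v \<and> p v \<le> 1) \<and> (\<forall>e\<in>edges H. (\<Sum>v\<in>e. p v) = 1)}"

section \<open>Graphs, weighted independence number and weighted Shannon capacity\<close>

record 'a graph =
  nodes :: "'a set"
  adj :: "'a \<Rightarrow> 'a \<Rightarrow> bool"

definition NO_graph :: "'a hypergraph \<Rightarrow> 'a graph" where
  "NO_graph H = \<lparr> nodes = verts H,
     adj = (\<lambda>u v. u \<in> verts H \<and> v \<in> verts H \<and> u \<noteq> v \<and> \<not> (\<exists>e\<in>edges H. {u, v} \<subseteq> e)) \<rparr>"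

definition independent_set :: "'a graph \<Rightarrow> 'a set \<Rightarrow> bool" where
  "independent_set G I \<longleftrightarrow> I \<subseteq> nodes G \<and> (\<forall>u\<in>I. \<forall>v\<in>I. \<not> adj G u v)"

definition weighted_alpha :: "'a graph \<Rightarrow> ('a \<Rightarrow> real) \<Rightarrow> real" where
  "weighted_alpha G p = Max ((\<lambda>I. \<Sum>v\<in>I. p v) ` {I. independent_set G I})"

text \<open>Tuples indexed by \<open>{..<n}\<close> are extensional functions in \<open>{..<n} \<rightarrow>\<^sub>E V\<close>.\<close>

definition strong_power :: "'a graph \<Rightarrow> nat \<Rightarrow> (nat \<Rightarrow> 'a) graph" where
  "strong_power G n = \<lparr> nodes = {..<n} \<rightarrow>\<^sub>E nodes G,
     adj = (\<lambda>x y. x \<in> ({..<n} \<rightarrow>\<^sub>E nodes G) \<and> y \<in> ({..<n} \<rightarrow>\<^sub>E nodes G) \<and> x \<noteq> y \<and>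
                  (\<forall>i<n. x i = y i \<or> adj G (x i) (y i))) \<rparr>"

definition tensor_power :: "('a \<Rightarrow> real) \<Rightarrow> nat \<Rightarrow> (nat \<Rightarrow> 'a) \<Rightarrow> real" where
  "tensor_power p n x = (\<Prod>i<n. p (x i))"

definition shannon_capacity :: "'a graph \<Rightarrow> ('a \<Rightarrow> real) \<Rightarrow> real" where
  "shannon_capacity G p =
     lim (\<lambda>n. root n (weighted_alpha (strong_power G n) (tensor_power p n)))"

section \<open>Products of scenarios\<close>

text \<open>In \<open>Measure k e f\<close> only the values of \<open>f\<close> on \<open>e\<close> are relevant. The outcome sets of a
  protocol for \<open>S\<close> consist of extensional functions on \<open>S\<close>; the one on the empty set of parties
  is \<open>\<lambda>_. undefined\<close>.\<close>

datatype ('i, 'a) protocol = Done | Measure 'i "'a set" "'a \<Rightarrow> ('i, 'a) protocol"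

primrec is_protocol ::
    "('i \<Rightarrow> 'a hypergraph) \<Rightarrow> ('i, 'a) protocol \<Rightarrow> 'i set \<Rightarrow> bool" where
  "is_protocol H Done S \<longleftrightarrow> S = {}"
| "is_protocol H (Measure k e f) S \<longleftrightarrow>
     k \<in> S \<and> e \<in> edges (H k) \<and> (\<forall>v\<in>e. is_protocol H (f v) (S - {k}))"

primrec outcomes :: "('i, 'a) protocol \<Rightarrow> ('i \<Rightarrow> 'a) set" where
  "outcomes Done = {\<lambda>_. undefined}"
| "outcomes (Measure k e f) = (\<Union>v\<in>e. (\<lambda>x. x(k := v)) ` outcomes (f v))"

definition max_product :: "'i set \<Rightarrow> ('i \<Rightarrow> 'a hypergraph) \<Rightarrow> ('i \<Rightarrow> 'a) hypergraph" where
  "max_product S H = \<lparr> verts = (\<Pi>\<^sub>E i\<in>S. verts (H i)),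
     edges = {outcomes P | P. is_protocol H P S} \<rparr>"

subsection \<open>Iterated binary Foulis--Randall products\<close>

definition FR_product :: "'a hypergraph \<Rightarrow> 'b hypergraph \<Rightarrow> ('a \<times> 'b) hypergraph" where
  "FR_product A B = \<lparr> verts = verts A \<times> verts B,
     edges = {(\<Union>a\<in>e. {a} \<times> f a) | e f. e \<in> edges A \<and> (\<forall>a\<in>e. f a \<in> edges B)} \<union>
             {(\<Union>b\<in>e. f b \<times> {b}) | e f. e \<in> edges B \<and> (\<forall>b\<in>e. f b \<in> edges A)} \<rparr>"

definition relabel :: "('a \<Rightarrow> 'b) \<Rightarrow> 'a hypergraph \<Rightarrow> 'b hypergraph" where
  "relabel g H = \<lparr> verts = g ` verts H, edges = (\<lambda>e. g ` e) ` edges H \<rparr>"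

text \<open>Binary products with arbitrary bracketing, with nested pairs flattened to functions on the
  set of parties.\<close>

inductive iterated_FR_product ::
    "('i \<Rightarrow> 'a hypergraph) \<Rightarrow> 'i set \<Rightarrow> ('i \<Rightarrow> 'a) hypergraph \<Rightarrow> bool" for H where
  single: "iterated_FR_product H {i} (relabel (\<lambda>v. \<lambda>j\<in>{i}. v) (H i))"
| binary: "iterated_FR_product H S A \<Longrightarrow> iterated_FR_product H T B \<Longrightarrow> S \<inter> T = {} \<Longrightarrow>
     iterated_FR_product H (S \<union> T)
       (relabel (\<lambda>(x, y). override_on y x S) (FR_product A B))"

subsection \<open>The class of products\<close>

text \<open>All iterated binary products, the maximal product, and everything in between. For one and
  for two parties all products coincide. From three parties on there is also the minimal product,
  in which the settings of all parties but one are fixed in advance. It is not included: two tuples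
  which are orthogonal in a single component need not share an edge of it, so its non-orthogonality
  graph is in general not the strong product of those of the factors. For instance, the constant
  model \<open>1/2\<close> on the 7-cycle with two-element edges satisfies consistent exclusivity with respect to
  all minimal powers, although the fourth strong power of the non-orthogonality graph has an
  independent set of 17 tuples, of total weight \<open>17/16\<close>.\<close>

definition scenario_products ::
    "'i set \<Rightarrow> ('i \<Rightarrow> 'a hypergraph) \<Rightarrow> ('i \<Rightarrow> 'a) hypergraph set" where
  "scenario_products S H = {K. verts K = (\<Pi>\<^sub>E i\<in>S. verts (H i)) \<and>
     (\<exists>B. iterated_FR_product H S B \<and> edges B \<subseteq> edges K) \<and>
     edges K \<subseteq> edges (max_product S H)}"

lemma outcomes_extensional: "is_protocol H P S \<Longrightarrow> x \<in> outcomes P \<Longrightarrow> x \<in> extensional S"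
proof (induction P arbitrary: S x)
  case Done
  then show ?case by (auto simp: extensional_def)
next
  case (Measure k e f)
  from Measure.prems(2) obtain v y where v: "v \<in> e" and y: "y \<in> outcomes (f v)"
    and x: "x = y(k := v)" by auto
  have "is_protocol H (f v) (S - {k})" using Measure.prems(1) v by simp
  then have "y \<in> extensional (S - {k})" using Measure.IH y by blast
  then show ?case using Measure.prems(1) x by (auto simp: extensional_def)
qed

lemma graft_protocol:
  assumes "is_protocol H P S" and "S \<inter> T = {}"
    and "\<And>x. x \<in> outcomes P \<Longrightarrow> \<exists>Q. is_protocol H Q T \<and> outcomes Q = F x"
  shows "\<exists>R. is_protocol H R (S \<union> T) \<and>
             outcomes R = (\<Union>x\<in>outcomes P. (\<lambda>y. override_on y x S) ` F x)"
  using assms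
proof (induction P arbitrary: S F)
  case Done
  then show ?case by (auto simp: override_on_def)
next
  case (Measure k e g)
  have ex: "\<exists>R. is_protocol H R ((S - {k}) \<union> T) \<and> outcomes R =
      (\<Union>x\<in>outcomes (g v). (\<lambda>y. override_on y x (S - {k})) ` F (x(k := v)))"
    if v: "v \<in> e" for v
  proof (rule Measure.IH)
    show "\<exists>Q. is_protocol H Q T \<and> outcomes Q = F (x(k := v))" if "x \<in> outcomes (g v)" for x
    proof (rule Measure.prems(3))
      show "x(k := v) \<in> outcomes (Measure k e g)"
        unfolding outcomes.simps using that v by blast
    qed
    show "is_protocol H (g v) (S - {k})" using Measure.prems(1) v by simp
    show "(S - {k}) \<inter> T = {}" using Measure.prems(2) by blast
  qed simp
  have "\<exists>R. \<forall>v \<in> e. is_protocol H (R v) ((S - {k}) \<union> T) \<and>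
      outcomes (R v) = (\<Union>x\<in>outcomes (g v). (\<lambda>y. override_on y x (S - {k})) ` F (x(k := v)))"
    by (rule bchoice, rule ballI) (rule ex)
  then obtain R where R: "\<forall>v \<in> e. is_protocol H (R v) ((S - {k}) \<union> T) \<and>
      outcomes (R v) = (\<Union>x\<in>outcomes (g v). (\<lambda>y. override_on y x (S - {k})) ` F (x(k := v)))"
    by (rule exE)
  have k: "k \<in> S" "k \<notin> T" using Measure.prems by auto
  have S: "(S \<union> T) - {k} = (S - {k}) \<union> T" using k by auto
  have *: "(override_on y x (S - {k}))(k := v) = override_on y (x(k := v)) S"
    for x y :: "'a \<Rightarrow> 'b" and v
    using k by (auto simp: override_on_def fun_eq_iff)
  have "is_protocol H (Measure k e R) (S \<union> T)"
    using R Measure.prems(1) by (auto simp: S)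
  moreover have "outcomes (Measure k e R) =
      (\<Union>x\<in>outcomes (Measure k e g). (\<lambda>y. override_on y x S) ` F x)"
    using R by (simp add: image_UN image_image * cong: SUP_cong)
  ultimately show ?case by blast
qed

lemma iterated_FR_product_le_max_product:
  assumes "iterated_FR_product H S K"
  shows "edges K \<subseteq> edges (max_product S H)"
  using assms
proof (induction rule: iterated_FR_product.induct)
  case (single i)
  show ?case
  proof
    fix E assume "E \<in> edges (relabel (\<lambda>v. \<lambda>j\<in>{i}. v) (H i))"
    then obtain e where e: "e \<in> edges (H i)" "E = (\<lambda>v. \<lambda>j\<in>{i}. v) ` e"
      by (auto simp: relabel_def)
    have "is_protocol H (Measure i e (\<lambda>_. Done)) {i}" using e by simp
    moreover have "outcomes (Measure i e (\<lambda>_. Done)) = E"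
      using e by (auto simp: restrict_def fun_upd_def image_def)
    ultimately have "\<exists>P. is_protocol H P {i} \<and> outcomes P = E" by blast
    then show "E \<in> edges (max_product {i} H)" by (auto simp: max_product_def)
  qed
next
  case (binary S A T B)
  have A: "\<exists>P. is_protocol H P S \<and> outcomes P = e" if "e \<in> edges A" for e
    using binary.IH(1) that by (auto simp: max_product_def)
  have B: "\<exists>P. is_protocol H P T \<and> outcomes P = e" if "e \<in> edges B" for e
    using binary.IH(2) that by (auto simp: max_product_def)
  show ?case
  proof
    fix E assume "E \<in> edges (relabel (\<lambda>(x, y). override_on y x S) (FR_product A B))"
    then consider (1) e f where "e \<in> edges A" "\<forall>a\<in>e. f a \<in> edges B"
        "E = (\<lambda>(x, y). override_on y x S) ` (\<Union>a\<in>e. {a} \<times> f a)"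
      | (2) e f where "e \<in> edges B" "\<forall>b\<in>e. f b \<in> edges A"
        "E = (\<lambda>(x, y). override_on y x S) ` (\<Union>b\<in>e. f b \<times> {b})"
      unfolding relabel_def FR_product_def by auto
    then have "\<exists>R. is_protocol H R (S \<union> T) \<and> outcomes R = E"
    proof cases
      case 1
      obtain P where P: "is_protocol H P S" "outcomes P = e" using A 1 by blast
      obtain R where "is_protocol H R (S \<union> T)"
        "outcomes R = (\<Union>x\<in>outcomes P. (\<lambda>y. override_on y x S) ` f x)"
        using graft_protocol[OF P(1) binary.hyps(3), of f] B P(2) 1(2) by auto
      moreover have "E = (\<Union>x\<in>outcomes P. (\<lambda>y. override_on y x S) ` f x)"
        unfolding 1(3) P(2) by auto
      ultimately show ?thesis by blast
    next
      case 2
      obtain P where P: "is_protocol H P T" "outcomes P = e" using B 2 by blast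
      have TS: "T \<inter> S = {}" using binary.hyps(3) by blast
      obtain R where "is_protocol H R (T \<union> S)"
        "outcomes R = (\<Union>y\<in>outcomes P. (\<lambda>x. override_on x y T) ` f y)"
        using graft_protocol[OF P(1) TS, of f] A P(2) 2(2) by auto
      moreover have "override_on x y T = override_on y x S"
        if "y \<in> e" "x \<in> f y" for x y
      proof -
        have "y \<in> extensional T" using outcomes_extensional[OF P(1)] P(2) that by auto
        moreover have "x \<in> extensional S" using A[of "f y"] 2(2) that outcomes_extensional by blast
        ultimately show ?thesis using TS
          by (auto simp: override_on_def fun_eq_iff extensional_def)
      qed
      then have "E = (\<Union>y\<in>outcomes P. (\<lambda>x. override_on x y T) ` f y)"
        unfolding 2(3) P(2) by (auto simp: image_iff)
      ultimately show ?thesis by (metis Un_commute)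
    qed
    then show "E \<in> edges (max_product (S \<union> T) H)" by (auto simp: max_product_def)
  qed
qed

lemma override_on_PiE_image:
  assumes "S \<inter> T = {}"
  shows "(\<lambda>(x, y). override_on y x S) ` (Pi\<^sub>E S V \<times> Pi\<^sub>E T V) = Pi\<^sub>E (S \<union> T) V"
proof (intro set_eqI iffI)
  fix z assume "z \<in> (\<lambda>(x, y). override_on y x S) ` (Pi\<^sub>E S V \<times> Pi\<^sub>E T V)"
  then show "z \<in> Pi\<^sub>E (S \<union> T) V"
    using assms by (auto simp: override_on_def PiE_def Pi_def extensional_def)
next
  fix z assume z: "z \<in> Pi\<^sub>E (S \<union> T) V"
  have "override_on (restrict z T) (restrict z S) S = z"
    using z by (auto simp: override_on_def fun_eq_iff PiE_def extensional_def)
  moreover have "restrict z S \<in> Pi\<^sub>E S V" "restrict z T \<in> Pi\<^sub>E T V" using z by auto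
  ultimately show "z \<in> (\<lambda>(x, y). override_on y x S) ` (Pi\<^sub>E S V \<times> Pi\<^sub>E T V)"
    by (intro image_eqI[where x = "(restrict z S, restrict z T)"]) auto
qed

lemma iterated_FR_product_verts:
  assumes "iterated_FR_product H S K"
  shows "S \<noteq> {} \<and> finite S \<and> verts K = (\<Pi>\<^sub>E i\<in>S. verts (H i))"
  using assms
proof (induction rule: iterated_FR_product.induct)
  case (single i)
  have "(\<Pi>\<^sub>E j\<in>{i}. verts (H j)) = (\<lambda>v. \<lambda>j\<in>{i}. v) ` verts (H i)"
    by (auto simp: PiE_insert_eq restrict_def fun_upd_def image_def)
  then show ?case by (simp add: relabel_def)
next
  case (binary S A T B)
  then show ?case
    using override_on_PiE_image[OF binary.hyps(3), of "\<lambda>i. verts (H i)"]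
    by (simp add: relabel_def FR_product_def)
qed

lemma iterated_FR_product_exists:
  assumes "finite S" and "S \<noteq> {}"
  shows "\<exists>B. iterated_FR_product H S B"
  using assms
proof (induction S rule: finite_ne_induct)
  case (singleton i)
  show ?case by (rule exI, rule iterated_FR_product.single)
next
  case (insert i S)
  then obtain B where "iterated_FR_product H S B" by blast
  from iterated_FR_product.binary[OF iterated_FR_product.single this] insert.hyps
  show ?case by auto
qed

lemma iterated_FR_product_in_scenario_products:
  assumes "iterated_FR_product H S K"
  shows "K \<in> scenario_products S H"
  using assms iterated_FR_product_le_max_product[OF assms] iterated_FR_product_verts[OF assms]
  by (auto simp: scenario_products_def)

lemma max_product_in_scenario_products:
  assumes "finite S" and "S \<noteq> {}"
  shows "max_product S H \<in> scenario_products S H"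
proof -
  obtain B where "iterated_FR_product H S B"
    using iterated_FR_product_exists[OF assms] by blast
  then show ?thesis
    using iterated_FR_product_le_max_product[of H S B]
    by (auto simp: scenario_products_def max_product_def)
qed

section \<open>Consistent exclusivity\<close>

definition CE1 :: "'a hypergraph \<Rightarrow> ('a \<Rightarrow> real) set" where
  "CE1 H = {p \<in> prob_models H. \<forall>I. independent_set (NO_graph H) I \<longrightarrow> (\<Sum>v\<in>I. p v) \<le> 1}"

text \<open>A choice of product \<open>K n\<close> for every \<open>n \<ge> 1\<close>; the choices for different \<open>n\<close> are
  independent of each other.\<close>

definition product_choice ::
    "'a hypergraph \<Rightarrow> (nat \<Rightarrow> (nat \<Rightarrow> 'a) hypergraph) \<Rightarrow> bool" where
  "product_choice H K \<longleftrightarrow> (\<forall>n\<ge>1. K n \<in> scenario_products {..<n} (\<lambda>_. H))"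

definition CE ::
    "'a hypergraph \<Rightarrow> (nat \<Rightarrow> (nat \<Rightarrow> 'a) hypergraph) \<Rightarrow> nat \<Rightarrow> ('a \<Rightarrow> real) set" where
  "CE H K n = {p \<in> prob_models H. tensor_power p n \<in> CE1 (K n)}"

definition CE_infinity ::
    "'a hypergraph \<Rightarrow> (nat \<Rightarrow> (nat \<Rightarrow> 'a) hypergraph) \<Rightarrow> ('a \<Rightarrow> real) set" where
  "CE_infinity H K = (\<Inter>n\<in>{1..}. CE H K n)"

end

theory Submission
  imports Defs
begin

text \<open>
  Every product lies between an iterated binary product and the maximal one. In the latter, two
  tuples in a common edge are separated by a measurement on which their branches diverge; in the
  former, the tuples orthogonal in some component already share an edge. Hence the
  non-orthogonality graph of each product is the strong power, which gives (a). For (b), the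
  weights of the strong powers are supermultiplicative and at least 1 on a nonempty scenario, since
  edges are independent. So the roots converge to their supremum, by Fekete's lemma applied to the
  logarithms, and this supremum is at most 1 iff all weights are.
\<close>

section \<open>Superadditive sequences\<close>

text \<open>Write n as a multiple of a fixed m plus a remainder. Superadditivity bounds
  \<open>f n\<close> below by \<open>n div m\<close> copies of \<open>f m\<close>, and nonnegativity
  allows the value at the remainder to be dropped. The linear bound makes the supremum a genuine
  one.\<close>

lemma superadditive_limit:
  fixes f :: "nat \<Rightarrow> real"
  assumes super: "\<And>m n. f m + f n \<le> f (m + n)"
    and nonneg: "\<And>n. 0 \<le> f n"
    and bound: "\<And>n. f n \<le> C * real n"
  shows "(\<lambda>n. f n / real n) \<longlonglongrightarrow> (SUP n\<in>{1..}. f n / real n)" (is "_ \<longlonglongrightarrow> ?L")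
proof -
  have "f n / real n \<le> C" if "n \<in> {1..}" for n
    using bound[of n] that by (simp add: field_simps)
  then have bdd: "bdd_above ((\<lambda>n. f n / real n) ` {1..})"
    by (rule bdd_aboveI2)
  have upper: "f n / real n \<le> ?L" if "n \<ge> 1" for n
    using that by (intro cSUP_upper bdd) auto
  have multiple: "real q * f m \<le> f (q * m)" for q m
  proof (induction q)
    case (Suc q)
    then show ?case using super[of m "q * m"] by (simp add: algebra_simps)
  qed (use nonneg in simp)
  \<comment> \<open>For fixed m the left side tends to \<open>f m / real m\<close> as n grows, so
    \<open>f n / real n\<close> eventually exceeds every number below \<open>?L\<close>. The
    correction term comes from \<open>n div m\<close> being at least n/m - 1.\<close>
  have lower: "f m / real m - f m / real n \<le> f n / real n" if "m \<ge> 1" "n \<ge> 1" for m n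
  proof -
    have "real n = real (n div m) * real m + real (n mod m)"
      by (metis div_mult_mod_eq of_nat_add of_nat_mult)
    moreover have "real (n mod m) \<le> real m"
      using that by (simp add: less_imp_le)
    ultimately have "real n / real m - 1 \<le> real (n div m)"
      using that by (simp add: field_simps)
    then have "(real n / real m - 1) * f m \<le> real (n div m) * f m"
      using nonneg by (rule mult_right_mono)
    also have "\<dots> \<le> f (n div m * m)"
      by (rule multiple)
    also have "\<dots> \<le> f n"
      using super[of "n div m * m" "n mod m"] nonneg[of "n mod m"] by simp
    finally have "(real n / real m - 1) * f m / real n \<le> f n / real n"
      by (rule divide_right_mono) simp
    moreover have "(real n / real m - 1) * f m / real n = f m / real m - f m / real n"
      using that by (simp add: field_simps)
    ultimately show ?thesis by simp
  qed
  show ?thesis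
  proof (rule order_tendstoI)
    fix a assume "a < ?L"
    then obtain m where m: "m \<ge> 1" "a < f m / real m"
      using less_cSUP_iff[OF _ bdd] by auto
    have "(\<lambda>n. f m / real m - f m / real n) \<longlonglongrightarrow> f m / real m - 0"
      by (intro tendsto_diff tendsto_const lim_const_over_n)
    then have "\<forall>\<^sub>F n in sequentially. a < f m / real m - f m / real n"
      using m(2) by (auto dest: order_tendstoD)
    then show "\<forall>\<^sub>F n in sequentially. a < f n / real n"
      using eventually_ge_at_top[of 1]
      by eventually_elim (use lower[OF m(1)] in fastforce)
  next
    fix a assume "?L < a"
    show "\<forall>\<^sub>F n in sequentially. f n / real n < a"
      using eventually_ge_at_top[of 1]
      by eventually_elim (use upper \<open>?L < a\<close> in fastforce)
  qed
qed

section \<open>Orthogonality in products of scenarios\<close>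

text \<open>Run the protocol along both tuples. If the first results differ, both lie in the
  measured edge \<open>e\<close> and party \<open>k\<close> is the witness. If they agree, the
  remainders of the tuples differ inside the same subprotocol, and the witness found there is a
  party other than \<open>k\<close>, untouched by the update.\<close>

lemma max_product_edge_orthogonal:
  assumes "is_protocol H P S" "x \<in> outcomes P" "y \<in> outcomes P" "x \<noteq> y"
  shows "\<exists>i\<in>S. x i \<noteq> y i \<and> (\<exists>e\<in>edges (H i). {x i, y i} \<subseteq> e)"
  using assms
proof (induction P arbitrary: S x y)
  case Done
  then show ?case by simp
next
  case (Measure k e f)
  from Measure.prems(2,3) obtain v w x' y' where
    v: "v \<in> e" "x' \<in> outcomes (f v)" "x = x'(k := v)" and
    w: "w \<in> e" "y' \<in> outcomes (f w)" "y = y'(k := w)"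
    by auto
  show ?case
  proof (cases "v = w")
    case True
    then have "x' \<noteq> y'" using Measure.prems(4) v w by auto
    moreover have "is_protocol H (f v) (S - {k})" using Measure.prems(1) v by simp
    ultimately obtain i where "i \<in> S - {k}" "x' i \<noteq> y' i" "\<exists>e\<in>edges (H i). {x' i, y' i} \<subseteq> e"
      using Measure.IH[of "f v" "S - {k}" x' y'] v w True by blast
    then show ?thesis using v w by (intro bexI[of _ i]) auto
  next
    case False
    then show ?thesis using Measure.prems(1) v w by (intro bexI[of _ k]) auto
  qed
qed

text \<open>Supplies edges through the part of a tuple on which nothing is known about
  orthogonality.\<close>

lemma iterated_FR_product_edge_cover:
  assumes "iterated_FR_product H S B"
    and "\<And>i. i \<in> S \<Longrightarrow> \<Union> (edges (H i)) = verts (H i)"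
    and "x \<in> (\<Pi>\<^sub>E i\<in>S. verts (H i))"
  shows "\<exists>E\<in>edges B. x \<in> E"
  using assms
proof (induction arbitrary: x rule: iterated_FR_product.induct)
  case (single i)
  then obtain e where e: "e \<in> edges (H i)" "x i \<in> e" by (auto simp: PiE_def Pi_def)
  have "x = (\<lambda>j\<in>{i}. x i)"
    using single.prems(2) by (auto simp: PiE_def extensional_def fun_eq_iff)
  then have "x \<in> (\<lambda>v. \<lambda>j\<in>{i}. v) ` e" using e by blast
  then show ?case using e by (auto simp: relabel_def)
next
  case (binary S A T B)
  have mem: "restrict x S \<in> (\<Pi>\<^sub>E i\<in>S. verts (H i))" "restrict x T \<in> (\<Pi>\<^sub>E i\<in>T. verts (H i))"
    using binary.prems(2) by auto
  obtain e e' where e: "e \<in> edges A" "restrict x S \<in> e" and e': "e' \<in> edges B" "restrict x T \<in> e'"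
    using binary.IH(1)[OF _ mem(1)] binary.IH(2)[OF _ mem(2)] binary.prems(1)
    by (meson UnI1 UnI2)
  \<comment> \<open>A constant choice function turns any pair of edges into a product edge.\<close>
  have "(\<Union>a\<in>e. {a} \<times> e') \<in> edges (FR_product A B)"
    unfolding FR_product_def hypergraph.simps using e e'
    by (intro UnI1 CollectI exI[of _ e] exI[of _ "\<lambda>_. e'"]) simp
  moreover have "x = override_on (restrict x T) (restrict x S) S"
    using binary.prems(2) by (auto simp: override_on_def fun_eq_iff PiE_def extensional_def)
  then have "x \<in> (\<lambda>(x, y). override_on y x S) ` (\<Union>a\<in>e. {a} \<times> e')"
    using e e' by (intro image_eqI[of _ _ "(restrict x S, restrict x T)"]) auto
  ultimately show ?case unfolding relabel_def hypergraph.simps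
    by (intro bexI[OF _ imageI])
qed

text \<open>Measure first the factor containing party \<open>i\<close>, with an edge holding both
  restrictions. The two outcomes there are distinct, so the edge measured next in the other factor
  can be chosen separately for each of them; covering edges suffice.\<close>

lemma iterated_FR_product_orthogonal_edge:
  assumes "iterated_FR_product H S B"
    and "\<And>i. i \<in> S \<Longrightarrow> \<Union> (edges (H i)) = verts (H i)"
    and "x \<in> (\<Pi>\<^sub>E i\<in>S. verts (H i))" "y \<in> (\<Pi>\<^sub>E i\<in>S. verts (H i))"
    and "i \<in> S" "x i \<noteq> y i" "e \<in> edges (H i)" "{x i, y i} \<subseteq> e"
  shows "\<exists>E\<in>edges B. {x, y} \<subseteq> E"
  using assms
proof (induction arbitrary: x y rule: iterated_FR_product.induct)
  case (single j)
  then have i: "i = j" by simp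
  have "x = (\<lambda>k\<in>{j}. x j)" "y = (\<lambda>k\<in>{j}. y j)"
    using single.prems(2,3) by (auto simp: PiE_def extensional_def fun_eq_iff)
  then have "{x, y} \<subseteq> (\<lambda>v. \<lambda>k\<in>{j}. v) ` e" using single.prems(7) unfolding i by blast
  then show ?case using single.prems(6) unfolding i by (auto simp: relabel_def)
next
  case (binary S A T B)
  let ?g = "\<lambda>(x, y). override_on y x S"
  define xS where "xS = restrict x S"
  define xT where "xT = restrict x T"
  define yS where "yS = restrict y S"
  define yT where "yT = restrict y T"
  have mem: "xS \<in> (\<Pi>\<^sub>E i\<in>S. verts (H i))" "xT \<in> (\<Pi>\<^sub>E i\<in>T. verts (H i))"
    "yS \<in> (\<Pi>\<^sub>E i\<in>S. verts (H i))" "yT \<in> (\<Pi>\<^sub>E i\<in>T. verts (H i))"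
    using binary.prems(2,3) by (auto simp: xS_def xT_def yS_def yT_def)
  have split: "x = ?g (xS, xT)" "y = ?g (yS, yT)"
    using binary.prems(2,3)
    by (auto simp: override_on_def fun_eq_iff PiE_def extensional_def xS_def xT_def yS_def yT_def)
  have cA: "\<exists>E\<in>edges A. z \<in> E" if "z \<in> (\<Pi>\<^sub>E i\<in>S. verts (H i))" for z
    using that binary.prems(1) by (intro iterated_FR_product_edge_cover[OF binary.hyps(1)]) auto
  have cB: "\<exists>E\<in>edges B. z \<in> E" if "z \<in> (\<Pi>\<^sub>E i\<in>T. verts (H i))" for z
    using that binary.prems(1) by (intro iterated_FR_product_edge_cover[OF binary.hyps(2)]) auto
  have "\<exists>E\<in>edges (FR_product A B). {(xS, xT), (yS, yT)} \<subseteq> E"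
  proof (cases "i \<in> S")
    case True
    then have i: "xS i = x i" "yS i = y i" by (auto simp: xS_def yS_def)
    have "\<exists>E\<in>edges A. {xS, yS} \<subseteq> E"
      by (rule binary.IH(1)) (use mem i True binary.prems in auto)
    then obtain e where e: "e \<in> edges A" "xS \<in> e" "yS \<in> e" by auto
    obtain e1 e2 where e12: "e1 \<in> edges B" "xT \<in> e1" "e2 \<in> edges B" "yT \<in> e2"
      using cB mem(2,4) by blast
    \<comment> \<open>Distinctness is what sends \<open>yS\<close> to the \<open>else\<close>
      branch, so that \<open>e2\<close> catches \<open>yT\<close> while \<open>e1\<close> catches
      \<open>xT\<close>.\<close>
    have "xS \<noteq> yS" using i binary.prems(5) by metis
    then have "{(xS, xT), (yS, yT)} \<subseteq> (\<Union>a\<in>e. {a} \<times> (if a = xS then e1 else e2))"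
      using e e12 by auto
    moreover have "(\<Union>a\<in>e. {a} \<times> (if a = xS then e1 else e2)) \<in> edges (FR_product A B)"
      unfolding FR_product_def hypergraph.simps using e e12
      by (intro UnI1 CollectI exI[of _ e] exI[of _ "\<lambda>a. if a = xS then e1 else e2"]) simp
    ultimately show ?thesis by blast
  next
    \<comment> \<open>The mirror image: the factor on \<open>T\<close> is measured first, which uses
      the other family of Foulis-Randall edges.\<close>
    case False
    then have "i \<in> T" using binary.prems(4) by blast
    then have i: "xT i = x i" "yT i = y i" by (auto simp: xT_def yT_def)
    have "\<exists>E\<in>edges B. {xT, yT} \<subseteq> E"
      by (rule binary.IH(2)) (use mem i \<open>i \<in> T\<close> binary.prems in auto)
    then obtain e where e: "e \<in> edges B" "xT \<in> e" "yT \<in> e" by auto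
    obtain e1 e2 where e12: "e1 \<in> edges A" "xS \<in> e1" "e2 \<in> edges A" "yS \<in> e2"
      using cA mem(1,3) by blast
    have "xT \<noteq> yT" using i binary.prems(5) by metis
    then have "{(xS, xT), (yS, yT)} \<subseteq> (\<Union>b\<in>e. (if b = xT then e1 else e2) \<times> {b})"
      using e e12 by auto
    moreover have "(\<Union>b\<in>e. (if b = xT then e1 else e2) \<times> {b}) \<in> edges (FR_product A B)"
      unfolding FR_product_def hypergraph.simps using e e12
      by (intro UnI2 CollectI exI[of _ e] exI[of _ "\<lambda>b. if b = xT then e1 else e2"]) simp
    ultimately show ?thesis by blast
  qed
  then obtain E where "E \<in> edges (FR_product A B)" "{(xS, xT), (yS, yT)} \<subseteq> E" ..
  moreover from this(2) have "{x, y} \<subseteq> ?g ` E" unfolding split by blast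
  ultimately show ?case unfolding relabel_def hypergraph.simps by (intro bexI[of _ "?g ` E"] imageI)
qed

lemma NO_graph_product:
  assumes "contextuality_scenario H" and "K \<in> scenario_products {..<n} (\<lambda>_. H)"
  shows "NO_graph K = strong_power (NO_graph H) n"
proof -
  have cover: "\<Union> (edges H) = verts H"
    using assms(1) by (simp add: contextuality_scenario_def)
  obtain B where verts: "verts K = {..<n} \<rightarrow>\<^sub>E verts H"
    and B: "iterated_FR_product (\<lambda>_. H) {..<n} B" "edges B \<subseteq> edges K"
    and max: "edges K \<subseteq> edges (max_product {..<n} (\<lambda>_. H))"
    using assms(2) by (auto simp: scenario_products_def)
  \<comment> \<open>Sharing an edge is monotone in the edge set. The maximal product therefore
    yields the forward direction and the iterated product \<open>B\<close> the backward one.\<close>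
  have "(\<exists>E\<in>edges K. {x, y} \<subseteq> E) \<longleftrightarrow> (\<exists>i<n. x i \<noteq> y i \<and> (\<exists>e\<in>edges H. {x i, y i} \<subseteq> e))"
    if "x \<in> {..<n} \<rightarrow>\<^sub>E verts H" "y \<in> {..<n} \<rightarrow>\<^sub>E verts H" "x \<noteq> y" for x y
  proof
    assume "\<exists>E\<in>edges K. {x, y} \<subseteq> E"
    then obtain P where "is_protocol (\<lambda>_. H) P {..<n}" "x \<in> outcomes P" "y \<in> outcomes P"
      using max by (auto simp: max_product_def)
    from max_product_edge_orthogonal[OF this \<open>x \<noteq> y\<close>]
    show "\<exists>i<n. x i \<noteq> y i \<and> (\<exists>e\<in>edges H. {x i, y i} \<subseteq> e)" by auto
  next
    assume "\<exists>i<n. x i \<noteq> y i \<and> (\<exists>e\<in>edges H. {x i, y i} \<subseteq> e)"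
    then obtain i e where "i \<in> {..<n}" "x i \<noteq> y i" "e \<in> edges H" "{x i, y i} \<subseteq> e" by auto
    from iterated_FR_product_orthogonal_edge[OF B(1) cover that(1,2) this] B(2)
    show "\<exists>E\<in>edges K. {x, y} \<subseteq> E" by blast
  qed
  \<comment> \<open>Negating orthogonality in some component gives, in every component, equality or
    adjacency in the non-orthogonality graph: the adjacency of the strong product.\<close>
  moreover have "(\<forall>i<n. x i = y i \<or> adj (NO_graph H) (x i) (y i)) \<longleftrightarrow>
      \<not> (\<exists>i<n. x i \<noteq> y i \<and> (\<exists>e\<in>edges H. {x i, y i} \<subseteq> e))"
    if "x \<in> {..<n} \<rightarrow>\<^sub>E verts H" "y \<in> {..<n} \<rightarrow>\<^sub>E verts H" for x y
    using PiE_mem[OF that(1)] PiE_mem[OF that(2)]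
    unfolding NO_graph_def graph.simps by blast
  moreover have "nodes (NO_graph H) = verts H" by (simp add: NO_graph_def)
  ultimately have "adj (NO_graph K) x y = adj (strong_power (NO_graph H) n) x y" for x y
    unfolding NO_graph_def[of K] strong_power_def graph.simps verts by metis
  then show ?thesis
    by (intro graph.equality) (auto simp: fun_eq_iff NO_graph_def strong_power_def verts)
qed

section \<open>Product models on products of scenarios\<close>

text \<open>After result \<open>v\<close> of the first measurement the remaining product weights sum
  to 1 by induction, whatever subprotocol \<open>v\<close> selects. What is left is the sum of
  \<open>p k\<close> over the edge \<open>e\<close>.\<close>

lemma sum_outcomes:
  fixes p :: "'i \<Rightarrow> 'a \<Rightarrow> real"
  assumes "is_protocol H P S" and "finite S"
    and "\<And>i e. i \<in> S \<Longrightarrow> e \<in> edges (H i) \<Longrightarrow> finite e \<and> sum (p i) e = 1"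
  shows "finite (outcomes P) \<and> (\<Sum>x\<in>outcomes P. \<Prod>i\<in>S. p i (x i)) = 1"
  using assms
proof (induction P arbitrary: S)
  case Done
  then show ?case by simp
next
  case (Measure k e f)
  have k: "k \<in> S" "e \<in> edges (H k)" and f: "\<And>v. v \<in> e \<Longrightarrow> is_protocol H (f v) (S - {k})"
    using Measure.prems(1) by auto
  have e: "finite e" "sum (p k) e = 1" using Measure.prems(3)[OF k] by auto
  have IH: "finite (outcomes (f v))" "(\<Sum>x\<in>outcomes (f v). \<Prod>i\<in>S - {k}. p i (x i)) = 1"
    if "v \<in> e" for v
    using Measure.IH[OF _ f[OF that]] Measure.prems(2,3) by auto
  \<comment> \<open>Outcomes of \<open>f v\<close> are extensional on \<open>S - {k}\<close>, hence
    \<open>undefined\<close> at \<open>k\<close>, so overwriting that value loses no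
    information.\<close>
  have inj: "inj_on (\<lambda>x. x(k := v)) (outcomes (f v))" if "v \<in> e" for v
  proof (rule inj_onI)
    fix x y assume "x \<in> outcomes (f v)" "y \<in> outcomes (f v)" "x(k := v) = y(k := v)"
    moreover from this have "x k = undefined" "y k = undefined"
      using outcomes_extensional[OF f[OF that]] by (auto simp: extensional_def)
    ultimately show "x = y" by (metis fun_upd_triv fun_upd_upd)
  qed
  \<comment> \<open>Branches belonging to different results are disjoint, since their elements
    differ at \<open>k\<close>.\<close>
  have "(\<Sum>x\<in>(\<Union>v\<in>e. (\<lambda>x. x(k := v)) ` outcomes (f v)). \<Prod>i\<in>S. p i (x i)) =
      (\<Sum>v\<in>e. \<Sum>x\<in>(\<lambda>x. x(k := v)) ` outcomes (f v). \<Prod>i\<in>S. p i (x i))"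
    using e IH by (intro sum.UNION_disjoint) (auto dest: fun_upd_eqD)
  also have "\<dots> = (\<Sum>v\<in>e. \<Sum>x\<in>outcomes (f v). \<Prod>i\<in>S. p i ((x(k := v)) i))"
    by (rule sum.cong[OF refl]) (simp only: sum.reindex[OF inj] o_def)
  also have "\<dots> = (\<Sum>v\<in>e. \<Sum>x\<in>outcomes (f v). p k v * (\<Prod>i\<in>S - {k}. p i (x i)))"
    by (intro sum.cong refl) (simp add: prod.remove[OF Measure.prems(2) k(1)])
  also have "\<dots> = 1"
    using IH e by (simp flip: sum_distrib_left)
  finally show ?case using e IH by auto
qed

text \<open>Membership in \<open>CE1\<close> includes being a model on the product, which has to be
  established before \<open>CE\<close> reduces to a bound on independent sets. All edges of
  \<open>K\<close> are outcome sets of protocols, so normalisation comes from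
  \<open>sum_outcomes\<close>.\<close>

lemma tensor_power_prob_model:
  assumes "contextuality_scenario H" and "p \<in> prob_models H"
    and "K \<in> scenario_products {..<n} (\<lambda>_. H)"
  shows "tensor_power p n \<in> prob_models K"
proof -
  have verts: "verts K = {..<n} \<rightarrow>\<^sub>E verts H"
    and max: "edges K \<subseteq> edges (max_product {..<n} (\<lambda>_. H))"
    using assms(3) by (auto simp: scenario_products_def)
  have "finite e \<and> sum p e = 1" if "e \<in> edges H" for e
    using assms that by (auto simp: contextuality_scenario_def prob_models_def intro: finite_subset)
  then have "sum (tensor_power p n) E = 1" if "E \<in> edges K" for E
    using max that sum_outcomes[of "\<lambda>_. H" _ "{..<n}" "\<lambda>_. p"]
    by (auto simp: max_product_def tensor_power_def)
  moreover have "0 \<le> tensor_power p n x \<and> tensor_power p n x \<le> 1" if "x \<in> verts K" for x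
    using that assms(2) unfolding tensor_power_def verts
    by (auto simp: prob_models_def PiE_iff intro!: prod_nonneg prod_le_1)
  ultimately show ?thesis by (auto simp: prob_models_def)
qed

section \<open>Weighted independence numbers of strong powers\<close>

lemma finite_independent_sets: "finite (nodes G) \<Longrightarrow> finite {I. independent_set G I}"
  by (rule finite_subset[of _ "Pow (nodes G)"]) (auto simp: independent_set_def)

text \<open>Ensures that the \<open>Max\<close> in \<open>weighted_alpha\<close> ranges over a
  nonempty set.\<close>

lemma independent_set_empty: "independent_set G {}"
  by (simp add: independent_set_def)

lemma weighted_alpha_le_iff:
  assumes "finite (nodes G)"
  shows "weighted_alpha G p \<le> c \<longleftrightarrow> (\<forall>I. independent_set G I \<longrightarrow> sum p I \<le> c)"
  unfolding weighted_alpha_def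
  using finite_independent_sets[OF assms] independent_set_empty[of G]
  by (subst Max_le_iff) auto

lemma weighted_alpha_ge:
  "finite (nodes G) \<Longrightarrow> independent_set G I \<Longrightarrow> sum p I \<le> weighted_alpha G p"
  using weighted_alpha_le_iff by blast

lemma weighted_alpha_attained:
  assumes "finite (nodes G)"
  obtains I where "independent_set G I" "sum p I = weighted_alpha G p"
proof -
  have "weighted_alpha G p \<in> sum p ` {I. independent_set G I}"
    unfolding weighted_alpha_def
    using finite_independent_sets[OF assms] independent_set_empty[of G]
    by (intro Max_in) auto
  then show ?thesis using that by auto
qed

lemma finite_nodes_strong_power: "finite (nodes G) \<Longrightarrow> finite (nodes (strong_power G n))"
  by (auto simp: strong_power_def intro: finite_PiE)

text \<open>Concatenating the tuples of optimal independent sets of the two powers gives an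
  independent set of the larger power, and its weight is the product of the two weights.\<close>

lemma weighted_alpha_strong_power_mult:
  assumes "finite (nodes G)"
  shows "weighted_alpha (strong_power G m) (tensor_power p m) *
      weighted_alpha (strong_power G n) (tensor_power p n) \<le>
    weighted_alpha (strong_power G (m + n)) (tensor_power p (m + n))"
proof -
  note fin = finite_nodes_strong_power[OF assms]
  obtain I where I: "independent_set (strong_power G m) I"
      "sum (tensor_power p m) I = weighted_alpha (strong_power G m) (tensor_power p m)"
    by (rule weighted_alpha_attained[OF fin])
  obtain J where J: "independent_set (strong_power G n) J"
      "sum (tensor_power p n) J = weighted_alpha (strong_power G n) (tensor_power p n)"
    by (rule weighted_alpha_attained[OF fin])
  \<comment> \<open>Concatenation. From index \<open>m + n\<close> on it reads \<open>y\<close> at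
    an index of at least \<open>n\<close>, where \<open>y\<close> is \<open>undefined\<close>, so
    the result is again extensional.\<close>
  define c :: "(nat \<Rightarrow> 'a) \<times> (nat \<Rightarrow> 'a) \<Rightarrow> nat \<Rightarrow> 'a"
    where "c = (\<lambda>(x, y) i. if i < m then x i else y (i - m))"
  have c_low: "c (x, y) i = x i" if "i < m" for x y i
    using that by (simp add: c_def)
  have c_high: "c (x, y) (m + i) = y i" for x y i
    by (simp add: c_def)
  have IE: "x \<in> {..<m} \<rightarrow>\<^sub>E nodes G" if "x \<in> I" for x
    using I(1) that by (auto simp: independent_set_def strong_power_def)
  have JE: "y \<in> {..<n} \<rightarrow>\<^sub>E nodes G" if "y \<in> J" for y
    using J(1) that by (auto simp: independent_set_def strong_power_def)
  have cE: "c (x, y) \<in> {..<m + n} \<rightarrow>\<^sub>E nodes G" if "x \<in> I" "y \<in> J" for x y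
    using IE[OF that(1)] JE[OF that(2)] by (auto simp: c_def PiE_iff extensional_def)
  have ext: "x = x'" if "x \<in> {..<k} \<rightarrow>\<^sub>E nodes G" "x' \<in> {..<k} \<rightarrow>\<^sub>E nodes G" "\<And>i. i < k \<Longrightarrow> x i = x' i"
    for k and x x' :: "nat \<Rightarrow> 'a"
    using that by (intro PiE_ext) auto
  have inj: "inj_on c (I \<times> J)"
  proof (intro inj_onI, clarify)
    fix x y x' y' assume xy: "x \<in> I" "y \<in> J" "x' \<in> I" "y' \<in> J" and eq: "c (x, y) = c (x', y')"
    have "x = x'" using IE xy c_low eq by (intro ext[of _ m]) metis+
    moreover have "y = y'" using JE xy c_high eq by (intro ext[of _ n]) metis+
    ultimately show "x = x' \<and> y = y'" by simp
  qed
  have "independent_set (strong_power G (m + n)) (c ` (I \<times> J))"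
    unfolding independent_set_def
  proof (intro conjI ballI notI)
    show "c ` (I \<times> J) \<subseteq> nodes (strong_power G (m + n))"
      using cE by (auto simp: strong_power_def)
  next
    fix z z' assume "z \<in> c ` (I \<times> J)" "z' \<in> c ` (I \<times> J)" "adj (strong_power G (m + n)) z z'"
    then obtain x y x' y' where xy: "x \<in> I" "y \<in> J" "x' \<in> I" "y' \<in> J"
      and ne: "c (x, y) \<noteq> c (x', y')"
      and adj: "\<And>i. i < m + n \<Longrightarrow> c (x, y) i = c (x', y') i \<or> adj G (c (x, y) i) (c (x', y') i)"
      by (auto simp: strong_power_def)
    \<comment> \<open>Adjacency of concatenations passes to each block as equality or adjacency
      there. Independence of \<open>I\<close> and \<open>J\<close> rules out adjacency, so both
      blocks agree, contradicting \<open>ne\<close>.\<close>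
    have "\<forall>i<m. x i = x' i \<or> adj G (x i) (x' i)"
      using adj c_low by (metis trans_less_add1)
    then have "x = x'"
      using I(1) xy IE unfolding independent_set_def strong_power_def graph.simps by blast
    moreover have "\<forall>i<n. y i = y' i \<or> adj G (y i) (y' i)"
      using adj c_high by (metis nat_add_left_cancel_less)
    then have "y = y'"
      using J(1) xy JE unfolding independent_set_def strong_power_def graph.simps by blast
    ultimately show False using ne by simp
  qed
  then have "sum (tensor_power p (m + n)) (c ` (I \<times> J)) \<le>
      weighted_alpha (strong_power G (m + n)) (tensor_power p (m + n))"
    by (rule weighted_alpha_ge[OF fin])
  moreover have "(\<Prod>i<m + n. g i) = (\<Prod>i<m. g i) * (\<Prod>i<n. g (m + i))" for g :: "nat \<Rightarrow> real"
    by (induction n) (simp_all add: mult.assoc)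
  then have "tensor_power p (m + n) (c (x, y)) = tensor_power p m x * tensor_power p n y" for x y
    by (simp add: tensor_power_def c_low c_high)
  then have "sum (tensor_power p (m + n)) (c ` (I \<times> J)) =
      sum (tensor_power p m) I * sum (tensor_power p n) J"
    by (simp add: sum.reindex[OF inj] sum_product sum.cartesian_product case_prod_unfold)
      (metis (no_types, lifting) sum.cong prod.collapse)
  ultimately show ?thesis using I(2) J(2) by simp
qed

text \<open>The weight of all tuples together factorises into a power. After taking logarithms this
  is the linear bound required for the limit.\<close>

lemma weighted_alpha_strong_power_le:
  assumes "finite (nodes G)" and "\<And>v. v \<in> nodes G \<Longrightarrow> 0 \<le> p v"
  shows "weighted_alpha (strong_power G n) (tensor_power p n) \<le> sum p (nodes G) ^ n"
proof -
  have "sum (tensor_power p n) I \<le> sum p (nodes G) ^ n"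
    if "independent_set (strong_power G n) I" for I
  proof -
    have "sum (tensor_power p n) I \<le> sum (tensor_power p n) ({..<n} \<rightarrow>\<^sub>E nodes G)"
      using that assms
      by (intro sum_mono2)
        (auto simp: independent_set_def strong_power_def tensor_power_def PiE_iff
          intro: finite_PiE intro!: prod_nonneg)
    also have "\<dots> = sum p (nodes G) ^ n"
      using prod_sum_PiE[of "{..<n}" "\<lambda>_. nodes G" "\<lambda>_. p"] assms(1)
      by (simp add: tensor_power_def)
    finally show ?thesis .
  qed
  then show ?thesis
    using weighted_alpha_le_iff[OF finite_nodes_strong_power[OF assms(1)]] by blast
qed

text \<open>Vertices embed as tuples with a single component, preserving weights and independence.
  This links the weight of the graph itself to its powers.\<close>

lemma weighted_alpha_le_strong_power_1:
  assumes "finite (nodes G)"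
  shows "weighted_alpha G p \<le> weighted_alpha (strong_power G 1) (tensor_power p 1)"
proof -
  obtain I where I: "independent_set G I" "sum p I = weighted_alpha G p"
    by (rule weighted_alpha_attained[OF assms])
  let ?c = "\<lambda>v. \<lambda>i\<in>{..<1::nat}. v"
  have "?c v \<in> {..<1} \<rightarrow>\<^sub>E nodes G" if "v \<in> I" for v
    using I(1) that by (auto simp: independent_set_def)
  then have sub: "?c ` I \<subseteq> {..<1} \<rightarrow>\<^sub>E nodes G" by blast
  have "inj_on ?c I" by (rule inj_onI) (metis lessThan_iff restrict_apply' zero_less_one)
  then have "sum (tensor_power p 1) (?c ` I) = sum p I"
    by (simp add: sum.reindex tensor_power_def)
  moreover have "independent_set (strong_power G 1) (?c ` I)"
    using I(1) sub unfolding independent_set_def strong_power_def graph.simps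
    by (auto dest: bspec)
  ultimately show ?thesis
    using weighted_alpha_ge[OF finite_nodes_strong_power[OF assms]] I(2) by metis
qed

section \<open>Shannon capacity as a supremum\<close>

text \<open>The capacity is defined through \<open>lim\<close>, so convergence has to be proved
  first. The logarithms of the weights are superadditive, nonnegative by \<open>ge1\<close> and
  linearly bounded; hence the roots converge to the exponential of a supremum, which dominates each
  term.\<close>

lemma shannon_capacity_ge:
  assumes fin: "finite (nodes G)" and nonneg: "\<And>v. v \<in> nodes G \<Longrightarrow> 0 \<le> p v"
    and ge1: "\<And>n. 1 \<le> n \<Longrightarrow> 1 \<le> weighted_alpha (strong_power G n) (tensor_power p n)"
    and "1 \<le> n"
  shows "root n (weighted_alpha (strong_power G n) (tensor_power p n)) \<le> shannon_capacity G p"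
proof -
  let ?a = "\<lambda>n. weighted_alpha (strong_power G n) (tensor_power p n)"
  \<comment> \<open>Index 0 is outside \<open>ge1\<close>, but the limit lemma speaks of all
    indices. The zeroth power has the empty tuple as its only vertex, of weight 1 as an empty
    product.\<close>
  have zero: "1 \<le> ?a 0"
  proof -
    have "independent_set (strong_power G 0) {\<lambda>_. undefined}"
      by (simp add: independent_set_def strong_power_def)
    from weighted_alpha_ge[OF finite_nodes_strong_power[OF fin] this, of "tensor_power p 0"]
    show ?thesis by (simp add: tensor_power_def)
  qed
  have a: "1 \<le> ?a k" for k
    using ge1[of k] zero by (cases "k = 0") auto
  have le: "?a k \<le> sum p (nodes G) ^ k" for k
    by (rule weighted_alpha_strong_power_le[OF fin nonneg])
  have s: "1 \<le> sum p (nodes G)" using a[of 1] le[of 1] by simp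
  let ?f = "\<lambda>k. ln (?a k)"
  have bound: "?f k \<le> ln (sum p (nodes G)) * real k" for k
  proof -
    have "?f k \<le> ln (sum p (nodes G) ^ k)" using a[of k] le[of k] by (subst ln_le_cancel_iff) auto
    then show ?thesis using s by (simp add: ln_realpow mult.commute)
  qed
  let ?L = "SUP k\<in>{1..}. ?f k / real k"
  have lim: "(\<lambda>k. ?f k / real k) \<longlonglongrightarrow> ?L"
  proof (rule superadditive_limit[OF _ _ bound])
    show "0 \<le> ?f k" for k using a[of k] by simp
    show "?f j + ?f k \<le> ?f (j + k)" for j k
    proof -
      have "?f j + ?f k = ln (?a j * ?a k)" using a[of j] a[of k] by (subst ln_mult) auto
      also have "\<dots> \<le> ?f (j + k)"
        using weighted_alpha_strong_power_mult[OF fin, of j p k] a[of j] a[of k] a[of "j + k"]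
        by (subst ln_le_cancel_iff) (auto intro: mult_pos_pos less_le_trans[OF zero_less_one])
      finally show ?thesis .
    qed
  qed
  have root: "root k (?a k) = exp (?f k / real k)" if "1 \<le> k" for k
    using that a[of k] by (simp add: ln_root flip: ln_root)
  have "(\<lambda>k. exp (?f k / real k)) \<longlonglongrightarrow> exp ?L"
    by (intro tendsto_exp lim)
  \<comment> \<open>At index 0 the sequences differ, \<open>root 0\<close> being 0 and the
    exponential 1, so they are only compared from 1 on.\<close>
  then have "(\<lambda>k. root k (?a k)) \<longlonglongrightarrow> exp ?L"
    by (rule Lim_transform_eventually)
      (use root in \<open>auto simp: eventually_at_top_linorder intro!: exI[of _ 1]\<close>)
  then have cap: "shannon_capacity G p = exp ?L"
    unfolding shannon_capacity_def by (rule limI)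
  have "?f k / real k \<le> ln (sum p (nodes G))" if "k \<in> {1..}" for k
    using bound[of k] that by (simp add: field_simps)
  then have "bdd_above ((\<lambda>k. ?f k / real k) ` {1..})"
    by (rule bdd_aboveI2)
  then have "?f n / real n \<le> ?L"
    using \<open>1 \<le> n\<close> by (intro cSUP_upper) auto
  then show ?thesis using root[OF \<open>1 \<le> n\<close>] cap by simp
qed

section \<open>Consistent exclusivity and capacity\<close>

text \<open>This is the source of the lower bound 1: a model gives weight 1 to every edge.\<close>

lemma edge_independent: "e \<in> edges H \<Longrightarrow> e \<subseteq> verts H \<Longrightarrow> independent_set (NO_graph H) e"
  by (auto simp: independent_set_def NO_graph_def)

text \<open>The form with equalities is stated for nonempty scenarios. On the empty scenario all
  weights of positive powers vanish, so consistent exclusivity holds at every level while the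
  capacity is 0 rather than 1.\<close>

theorem lemma7p3p2:
  fixes H :: "'a hypergraph"
    and K :: "nat \<Rightarrow> (nat \<Rightarrow> 'a) hypergraph"
    and p :: "'a \<Rightarrow> real"
  assumes "contextuality_scenario H"
    and "product_choice H K"
    and "p \<in> prob_models H"
  shows "(\<forall>n\<ge>1. p \<in> CE H K n \<longleftrightarrow>
            weighted_alpha (strong_power (NO_graph H) n) (tensor_power p n) \<le> 1) \<and>
         (p \<in> CE_infinity H K \<longleftrightarrow> shannon_capacity (NO_graph H) p \<le> 1) \<and>
         (verts H \<noteq> {} \<longrightarrow>
            (p \<in> CE_infinity H K \<longleftrightarrow>
               weighted_alpha (NO_graph H) p = 1 \<and> shannon_capacity (NO_graph H) p = 1))"
proof -
  let ?G = "NO_graph H"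
  let ?a = "\<lambda>n. weighted_alpha (strong_power ?G n) (tensor_power p n)"
  have fin: "finite (nodes ?G)" and nodes: "nodes ?G = verts H"
    using assms(1) by (auto simp: contextuality_scenario_def NO_graph_def)
  have K: "K n \<in> scenario_products {..<n} (\<lambda>_. H)" if "1 \<le> n" for n
    using assms(2) that by (simp add: product_choice_def)
  have CE: "p \<in> CE H K n \<longleftrightarrow> ?a n \<le> 1" if "1 \<le> n" for n
    using tensor_power_prob_model[OF assms(1,3) K[OF that]] assms(3)
      NO_graph_product[OF assms(1) K[OF that]]
      weighted_alpha_le_iff[OF finite_nodes_strong_power[OF fin]]
    by (auto simp: CE_def CE1_def)
  have CE_inf: "p \<in> CE_infinity H K \<longleftrightarrow> (\<forall>n\<ge>1. ?a n \<le> 1)"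
    using CE by (auto simp: CE_infinity_def)
  have const: "shannon_capacity ?G p = c"
    if "\<And>n. 1 \<le> n \<Longrightarrow> root n (?a n) = c" for c
    unfolding shannon_capacity_def
    by (intro limI tendsto_eventually)
      (use that in \<open>auto simp: eventually_at_top_linorder intro!: exI[of _ 1]\<close>)
  show ?thesis
  proof (cases "verts H = {}")
    case True
    \<comment> \<open>Positivity of n matters: the zeroth power would still contain the empty
      tuple.\<close>
    have "nodes (strong_power ?G n) = {}" if "1 \<le> n" for n
      using that True nodes by (auto simp: strong_power_def PiE_eq_empty_iff intro: exI[of _ 0])
    then have "{I. independent_set (strong_power ?G n) I} = {{}}" if "1 \<le> n" for n
      using that by (auto simp: independent_set_def)
    then have "?a n = 0" if "1 \<le> n" for n
      using that by (simp add: weighted_alpha_def)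
    moreover from this have "shannon_capacity ?G p = 0" by (intro const) simp
    ultimately show ?thesis using CE CE_inf True by simp
  next
    case False
    then obtain e where "e \<in> edges H"
      using assms(1) unfolding contextuality_scenario_def by blast
    then have e: "e \<in> edges H" "e \<subseteq> verts H" "sum p e = 1"
      using assms(1,3) by (auto simp: contextuality_scenario_def prob_models_def)
    have alpha1: "1 \<le> weighted_alpha ?G p"
      using weighted_alpha_ge[OF fin edge_independent[OF e(1,2)], of p] e(3) by simp
    \<comment> \<open>Supermultiplicativity carries the bound from the first power to all
      others.\<close>
    have ge1: "1 \<le> ?a n" if "1 \<le> n" for n
      using that
    proof (induction n rule: dec_induct)
      case base
      then show ?case using alpha1 weighted_alpha_le_strong_power_1[OF fin, of p] by simp
    next
      case (step n)
      have "1 * 1 \<le> ?a n * ?a 1"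
        using alpha1 weighted_alpha_le_strong_power_1[OF fin, of p] step.IH
        by (intro mult_mono) auto
      then show ?case
        using weighted_alpha_strong_power_mult[OF fin, of n p 1] by simp
    qed
    have nonneg: "0 \<le> p v" if "v \<in> nodes ?G" for v
      using that nodes assms(3) by (auto simp: prob_models_def)
    have cap: "root n (?a n) \<le> shannon_capacity ?G p" if "1 \<le> n" for n
      using shannon_capacity_ge[OF fin nonneg ge1 that] .
    have le: "p \<in> CE_infinity H K" if "shannon_capacity ?G p \<le> 1"
      unfolding CE_inf
    proof (intro allI impI)
      fix n :: nat assume n: "1 \<le> n"
      have "root n (?a n) \<le> 1" using cap[OF n] that by (rule order_trans)
      then show "?a n \<le> 1" using n by simp
    qed
    have eq: "weighted_alpha ?G p = 1 \<and> shannon_capacity ?G p = 1" if "p \<in> CE_infinity H K"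
    proof -
      have one: "?a n = 1" if "1 \<le> n" for n
        using ge1[OF that] that CE_inf \<open>p \<in> CE_infinity H K\<close> by (auto intro: antisym)
      then have "weighted_alpha ?G p = 1"
        using alpha1 weighted_alpha_le_strong_power_1[OF fin, of p] by simp
      moreover have "shannon_capacity ?G p = 1" using one by (intro const) simp
      ultimately show ?thesis ..
    qed
    \<comment> \<open>The implications close a cycle: capacity at most 1 gives exclusivity at all
      levels, this gives both equalities, and these give capacity at most 1.\<close>
    show ?thesis using CE le eq by force
  qed
qed

end
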